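(* Let $P=\{\mathcal{P}_1,\dots,\mathcal{P}_K\}$ be a polyhedral partition of $\mathbb{R}^d$ induced by a finite affine hyperplane arrangement, with $\mathcal{P}_k=\{x\in\mathbb{R}^d:A_kx<b_k\}$. Then every element of $\mathcal{F}_P^d$ is continuous on $(\mathbb{R}^d\setminus\Gamma_P)\times\mathbb{R}$.
   Context: Activations. $\operatorname{ReLU}(x)=\max\{0,x\}$ and $\mathcal{H}$ is the Heaviside function with $\mathcal{H}(r)=1$ for $r\ge0$ and $\mathcal{H}(r)=0$ for $r<0$; both are applied componentwise to vectors. For $J\in\mathbb{R}^k$, $\operatorname{ReLU}_J:\mathbb{R}^k\to\mathbb{R}^k$ is $\operatorname{ReLU}_J(x)=\operatorname{ReLU}(x)+J\odot\mathcal{H}(x)$, with $\odot$ the componentwise product. Network classes. For $d_1,d_2\in\mathbb{N}$, $\mathcal{F}_{\operatorname{ReLU}_J}^{d_1,d_2}$ is the set of all maps $\mathbb{R}^{d_1}\to\mathbb{R}^{d_2}$ of the form $W_L\circ\operatorname{ReLU}_{J_L}\circ\cdots\circ W_1\circ\operatorname{ReLU}_{J_1}\circ W_0$ with $L\in\mathbb{N}$, $W_\ell:\mathbb{R}^{h_\ell}\to\mathbb{R}^{h_{\ell+1}}$ affine for $\ell=0,\dots,L$, $J_\ell\in\mathbb{R}^{h_\ell}$ for $\ell=1,\dots,L$, $h_0=d_1$, $h_{L+1}=d_2$, and $h_1,\dots,h_L\in\mathbb{N}$ (depth, widths, affine maps and jump vectors are all arbitrary). $\mathcal{F}_{\operatorname{ReLU}}^{d_1,d_2}\subset\mathcal{F}_{\operatorname{ReLU}_J}^{d_1,d_2}$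 is the subclass in which all $J_\ell=0$. Geometry. The partition induced by a finite affine hyperplane arrangement $\{H_1,\dots,H_R\}$ of $\mathbb{R}^d$ is the collection $P=\{\mathcal{P}_1,\dots,\mathcal{P}_K\}$ of connected components of $\mathbb{R}^d\setminus\bigcup_{r}H_r$; each is an open convex cell $\mathcal{P}_k=\{x\in\mathbb{R}^d:A_kx<b_k\}$ (componentwise inequality), $A_k\in\mathbb{R}^{m_k\times d}$, $b_k\in\mathbb{R}^{m_k}$. Set $d_P=\sum_{k=1}^Km_k$; let $A_P$ and $b_P$ be the vertical stackings of $A_1,\dots,A_K$ and of $b_1,\dots,b_K$; $T_P(x)=b_P-A_Px\in\mathbb{R}^{d_P}$; $z_P(x)=\mathcal{H}(T_P(x))\in\{0,1\}^{d_P}$; and $\Gamma_P=\bigcup_{\ell=1}^{d_P}\{x\in\mathbb{R}^d:(T_P(x))_\ell=0\}$. Geometry-preserving class. $\mathcal{F}_P^d$ is the set of maps $\mathbb{R}^d\times\mathbb{R}\to\mathbb{R}^d$, $(x,t)\mapsto\Psi(x,t,\Phi(z_P(x)))$, with $\Phi\in\mathcal{F}_{\operatorname{ReLU}_J}^{d_P,d_1}$, $\Psi\in\mathcal{F}_{\operatorname{ReLU}}^{1+d+d_1,d}$, $d_1\in\mathbb{N}$. *)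

theory Defs
  imports "HOL-Analysis.Analysis"
begin

text \<open>
  The layer widths are bound inside the network classes, so dimensions have to be terms rather than
  types: the space \<open>\<real>\<^sup>n\<close> is \<^term>\<open>Euclidean_space n\<close>, whose points are the \<^typ>\<open>nat \<Rightarrow> real\<close> that
  vanish at all indices \<open>\<ge> n\<close> (coordinates are indexed by \<open>0, \<dots>, n - 1\<close>). A map out of \<open>\<real>\<^sup>m\<close> is a
  HOL function of which only the values on \<open>\<real>\<^sup>m\<close> matter; the classes of maps below are therefore
  closed under changing a map off its domain.
\<close>

abbreviation Rn :: "nat \<Rightarrow> (nat \<Rightarrow> real) set" where
  "Rn n \<equiv> topspace (Euclidean_space n)"

definition dot :: "nat \<Rightarrow> (nat \<Rightarrow> real) \<Rightarrow> (nat \<Rightarrow> real) \<Rightarrow> real" where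
  "dot n a x = (\<Sum>j<n. a j * x j)"


section \<open>Activations\<close>

definition ReLU :: "real \<Rightarrow> real" where
  "ReLU r = max 0 r"

definition Heaviside :: "real \<Rightarrow> real" where
  "Heaviside r = (if r \<ge> 0 then 1 else 0)"

text \<open>As \<open>Heaviside 0 = 1\<close>, componentwise application must be cut off at the dimension.\<close>

definition Heaviside_vec :: "nat \<Rightarrow> (nat \<Rightarrow> real) \<Rightarrow> nat \<Rightarrow> real" where
  "Heaviside_vec k x = (\<lambda>i. if i < k then Heaviside (x i) else 0)"

definition ReLU_jump :: "nat \<Rightarrow> (nat \<Rightarrow> real) \<Rightarrow> (nat \<Rightarrow> real) \<Rightarrow> nat \<Rightarrow> real" where
  "ReLU_jump k J x = (\<lambda>i. if i < k then ReLU (x i) + J i * Heaviside (x i) else 0)"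


section \<open>Network classes\<close>

definition affine_map :: "nat \<Rightarrow> nat \<Rightarrow> ((nat \<Rightarrow> real) \<Rightarrow> nat \<Rightarrow> real) \<Rightarrow> bool" where
  "affine_map m n W \<longleftrightarrow>
     (\<exists>(M :: nat \<Rightarrow> nat \<Rightarrow> real) c. \<forall>x \<in> Rn m. W x = (\<lambda>i. if i < n then dot m (M i) x + c i else 0))"

text \<open>\<open>network h W J L\<close> is \<open>W\<^sub>L \<circ> ReLU\<^sub>J\<^sub>L \<circ> \<dots> \<circ> W\<^sub>1 \<circ> ReLU\<^sub>J\<^sub>1 \<circ> W\<^sub>0\<close>, with \<open>h l\<close> the width of layer \<open>l\<close>.\<close>

primrec network ::
  "(nat \<Rightarrow> nat) \<Rightarrow> (nat \<Rightarrow> (nat \<Rightarrow> real) \<Rightarrow> nat \<Rightarrow> real) \<Rightarrow> (nat \<Rightarrow> nat \<Rightarrow> real) \<Rightarrow> nat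
     \<Rightarrow> (nat \<Rightarrow> real) \<Rightarrow> nat \<Rightarrow> real" where
  "network h W J 0 = W 0"
| "network h W J (Suc l) = W (Suc l) \<circ> ReLU_jump (h (Suc l)) (J (Suc l)) \<circ> network h W J l"

definition is_network ::
  "nat \<Rightarrow> nat \<Rightarrow> nat \<Rightarrow> (nat \<Rightarrow> nat) \<Rightarrow> (nat \<Rightarrow> (nat \<Rightarrow> real) \<Rightarrow> nat \<Rightarrow> real) \<Rightarrow> (nat \<Rightarrow> nat \<Rightarrow> real) \<Rightarrow> bool"
  where
  "is_network m n L h W J \<longleftrightarrow>
     L \<ge> 1 \<and> h 0 = m \<and> h (Suc L) = n \<and> (\<forall>l\<in>{1..L}. h l \<ge> 1) \<and>
     (\<forall>l\<le>L. affine_map (h l) (h (Suc l)) (W l)) \<and> (\<forall>l\<in>{1..L}. J l \<in> Rn (h l))"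

definition ReLU_jump_networks :: "nat \<Rightarrow> nat \<Rightarrow> ((nat \<Rightarrow> real) \<Rightarrow> nat \<Rightarrow> real) set" where
  "ReLU_jump_networks m n =
     {f. \<exists>L h W J. is_network m n L h W J \<and> (\<forall>x \<in> Rn m. f x = network h W J L x)}"

definition ReLU_networks :: "nat \<Rightarrow> nat \<Rightarrow> ((nat \<Rightarrow> real) \<Rightarrow> nat \<Rightarrow> real) set" where
  "ReLU_networks m n =
     {f. \<exists>L h W J. is_network m n L h W J \<and> (\<forall>l\<in>{1..L}. J l = (\<lambda>_. 0)) \<and>
           (\<forall>x \<in> Rn m. f x = network h W J L x)}"


section \<open>Polyhedral partitions\<close>

definition affine_hyperplane :: "nat \<Rightarrow> (nat \<Rightarrow> real) set \<Rightarrow> bool" where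
  "affine_hyperplane d H \<longleftrightarrow>
     (\<exists>a c. (\<exists>j<d. a j \<noteq> 0) \<and> H = {x \<in> Rn d. dot d a x = c})"

text \<open>
  A strict system \<open>A x < b\<close> with \<open>m\<close> rows is the list of length \<open>m\<close> of the pairs formed by a row of
  \<open>A\<close> and the corresponding entry of \<open>b\<close>, so that stacking systems is list concatenation.
\<close>

type_synonym system = "((nat \<Rightarrow> real) \<times> real) list"

definition cell :: "nat \<Rightarrow> system \<Rightarrow> (nat \<Rightarrow> real) set" where
  "cell d S = {x \<in> Rn d. \<forall>(a, \<beta>) \<in> set S. dot d a x < \<beta>}"

text \<open>The systems in \<open>Ss\<close> describe, each exactly once, the cells of the arrangement \<open>\<H>\<close>.\<close>

definition induced_partition :: "nat \<Rightarrow> (nat \<Rightarrow> real) set set \<Rightarrow> system list \<Rightarrow> bool" where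
  "induced_partition d \<H> Ss \<longleftrightarrow>
     distinct (map (cell d) Ss) \<and>
     set (map (cell d) Ss) =
       connected_components_of (subtopology (Euclidean_space d) (Rn d - \<Union>\<H>))"

definition d_P :: "system list \<Rightarrow> nat" where
  "d_P Ss = (\<Sum>S\<leftarrow>Ss. length S)"

definition T_P :: "nat \<Rightarrow> system list \<Rightarrow> (nat \<Rightarrow> real) \<Rightarrow> nat \<Rightarrow> real" where
  "T_P d Ss x =
     (\<lambda>l. if l < d_P Ss then snd (concat Ss ! l) - dot d (fst (concat Ss ! l)) x else 0)"

definition z_P :: "nat \<Rightarrow> system list \<Rightarrow> (nat \<Rightarrow> real) \<Rightarrow> nat \<Rightarrow> real" where
  "z_P d Ss x = Heaviside_vec (d_P Ss) (T_P d Ss x)"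

definition Gamma_P :: "nat \<Rightarrow> system list \<Rightarrow> (nat \<Rightarrow> real) set" where
  "Gamma_P d Ss = (\<Union>l<d_P Ss. {x \<in> Rn d. T_P d Ss x l = 0})"


section \<open>The geometry-preserving class\<close>

text \<open>The point \<open>(x, t, y)\<close> of \<open>\<real>\<^sup>d \<times> \<real> \<times> \<real>\<^sup>e = \<real>\<^sup>1\<^sup>+\<^sup>d\<^sup>+\<^sup>e\<close>.\<close>

definition join :: "nat \<Rightarrow> nat \<Rightarrow> (nat \<Rightarrow> real) \<Rightarrow> real \<Rightarrow> (nat \<Rightarrow> real) \<Rightarrow> nat \<Rightarrow> real" where
  "join d e x t y =
     (\<lambda>i. if i < d then x i else if i = d then t else if i < 1 + d + e then y (i - (d + 1)) else 0)"

definition geometry_preserving ::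
  "nat \<Rightarrow> system list \<Rightarrow> ((nat \<Rightarrow> real) \<times> real \<Rightarrow> nat \<Rightarrow> real) set" where
  "geometry_preserving d Ss =
     {F. \<exists>e \<Phi> \<Psi>. e \<ge> 1 \<and> \<Phi> \<in> ReLU_jump_networks (d_P Ss) e \<and> \<Psi> \<in> ReLU_networks (1 + d + e) d \<and>
           (\<forall>x \<in> Rn d. \<forall>t. F (x, t) = \<Psi> (join d e x t (\<Phi> (z_P d Ss x))))}"

end

theory Submission
  imports Defs
begin

text \<open>
  Off \<open>\<Gamma>\<^sub>P\<close> every coordinate of \<open>T\<^sub>P\<close> is continuous and nonzero, hence of locally constant sign, so
  \<open>z\<^sub>P\<close> is continuous there even for the discrete topology on its values. Therefore \<open>\<Phi> \<circ> z\<^sub>P\<close> is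
  continuous however discontinuous \<open>\<Phi>\<close> is, and it is fed into the continuous network \<open>\<Psi>\<close>.
\<close>

lemma Rn_eq: "Rn n = {x. \<forall>i\<ge>n. x i = 0}"
  by (simp add: topspace_Euclidean_space)

text \<open>Continuity into the ambient product concerns all indices, but the range condition forces
  those at or beyond \<open>n\<close> to be constantly 0 on \<open>topspace X\<close>, so the first
  \<open>n\<close> decide.\<close>

lemma continuous_map_Euclidean_space_iff:
  "continuous_map X (Euclidean_space n) f \<longleftrightarrow>
     (\<forall>i<n. continuous_map X euclideanreal (\<lambda>x. f x i)) \<and> f \<in> topspace X \<rightarrow> Rn n"
proof -
  have "continuous_map X euclideanreal (\<lambda>x. f x i)" if "f \<in> topspace X \<rightarrow> Rn n" "i \<ge> n" for i
    by (rule continuous_map_eq[of _ _ "\<lambda>_. 0"]) (use that in \<open>auto simp: Rn_eq Pi_iff\<close>)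
  then show ?thesis
    unfolding Rn_eq unfolding Euclidean_space_def continuous_map_in_subtopology
      continuous_map_componentwise_UNIV
    by (auto simp: image_subset_iff_funcset) (meson not_le_imp_less)
qed

lemma continuous_map_Euclidean_space_component:
  "continuous_map (Euclidean_space n) euclideanreal (\<lambda>x. x i)"
  unfolding Euclidean_space_def
  by (intro continuous_map_from_subtopology continuous_map_product_projection) simp

lemma continuous_map_dot:
  "continuous_map (Euclidean_space n) euclideanreal (dot n a)"
  unfolding dot_def
  by (intro continuous_map_sum continuous_map_real_mult continuous_map_Euclidean_space_component) auto

text \<open>\<open>W\<close> is prescribed only on \<open>Rn m\<close>, so continuity is transferred
  from the explicit formula, with which it agrees on the topspace.\<close>

lemma continuous_map_affine_map:
  assumes "affine_map m n W"
  shows "continuous_map (Euclidean_space m) (Euclidean_space n) W"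
proof -
  obtain M c where W: "\<And>x. x \<in> Rn m \<Longrightarrow> W x = (\<lambda>i. if i < n then dot m (M i) x + c i else 0)"
    using assms unfolding affine_map_def by blast
  have "continuous_map (Euclidean_space m) euclideanreal (\<lambda>x. W x i)" if "i < n" for i
    by (rule continuous_map_eq[of _ _ "\<lambda>x. dot m (M i) x + c i"])
      (use that in \<open>auto intro!: continuous_map_add continuous_map_dot simp: W\<close>)
  then show ?thesis
    by (auto simp: continuous_map_Euclidean_space_iff W) (auto simp: Rn_eq)
qed

lemma affine_map_in_Rn:
  assumes "affine_map m n W" "x \<in> Rn m"
  shows "W x \<in> Rn n"
  using continuous_map_image_subset_topspace[OF continuous_map_affine_map[OF assms(1)]] assms(2)
  by blast

lemma ReLU_jump_in_Rn: "ReLU_jump k J x \<in> Rn k"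
  by (simp add: Rn_eq ReLU_jump_def)

text \<open>With zero jump the Heaviside term vanishes and each coordinate is a maximum with
  0.\<close>

lemma continuous_map_ReLU_jump_0:
  "continuous_map (Euclidean_space k) (Euclidean_space k) (ReLU_jump k (\<lambda>_. 0))"
  by (auto simp: continuous_map_Euclidean_space_iff ReLU_jump_in_Rn)
    (auto simp: ReLU_jump_def ReLU_def
      intro!: continuous_map_real_max continuous_map_Euclidean_space_component)

text \<open>Only the outermost layer matters: \<open>ReLU_jump\<close> lands in the right space
  whatever its argument, and the last affine map does the rest.\<close>

lemma network_in_Rn:
  assumes "\<And>l. l \<le> L \<Longrightarrow> affine_map (h l) (h (Suc l)) (W l)" "x \<in> Rn (h 0)"
  shows "network h W J L x \<in> Rn (h (Suc L))"
  using assms by (cases L) (auto intro: affine_map_in_Rn ReLU_jump_in_Rn)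

lemma continuous_map_network:
  assumes "\<And>l. l \<le> L \<Longrightarrow> affine_map (h l) (h (Suc l)) (W l)"
    and "\<And>l. l \<in> {1..L} \<Longrightarrow> J l = (\<lambda>_. 0)"
  shows "continuous_map (Euclidean_space (h 0)) (Euclidean_space (h (Suc L))) (network h W J L)"
  using assms
proof (induction L)
  case 0
  then show ?case by (simp add: continuous_map_affine_map)
next
  case (Suc L)
  have J: "J (Suc L) = (\<lambda>_. 0)"
    using Suc.prems(2) by simp
  have "continuous_map (Euclidean_space (h (Suc L))) (Euclidean_space (h (Suc (Suc L)))) (W (Suc L))"
    using Suc.prems(1) by (intro continuous_map_affine_map) simp
  moreover have "continuous_map (Euclidean_space (h 0)) (Euclidean_space (h (Suc L))) (network h W J L)"
    by (rule Suc.IH) (use Suc.prems in auto)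
  ultimately show ?case
    unfolding network.simps J
    by (metis continuous_map_ReLU_jump_0 continuous_map_compose)
qed

text \<open>Having values in the right space is what makes such a map continuous on a discrete
  domain, whatever its jumps.\<close>

lemma ReLU_jump_networks_in_Rn:
  assumes "f \<in> ReLU_jump_networks m n" "x \<in> Rn m"
  shows "f x \<in> Rn n"
proof -
  obtain L h W J where "is_network m n L h W J" "f x = network h W J L x"
    using assms unfolding ReLU_jump_networks_def by blast
  then show ?thesis
    using network_in_Rn[of L h W x J] assms(2) unfolding is_network_def by auto
qed

lemma continuous_map_ReLU_networks:
  assumes "f \<in> ReLU_networks m n"
  shows "continuous_map (Euclidean_space m) (Euclidean_space n) f"
proof -
  obtain L h W J where N: "is_network m n L h W J" "\<And>l. l \<in> {1..L} \<Longrightarrow> J l = (\<lambda>_. 0)"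
    and f: "\<And>x. x \<in> Rn m \<Longrightarrow> f x = network h W J L x"
    using assms unfolding ReLU_networks_def by blast
  then have "continuous_map (Euclidean_space m) (Euclidean_space n) (network h W J L)"
    using continuous_map_network[of L h W J] unfolding is_network_def by auto
  then show ?thesis
    by (rule continuous_map_eq) (simp add: f)
qed

lemma continuous_map_join:
  assumes "continuous_map X (Euclidean_space d) f" "continuous_map X euclideanreal t"
    and "continuous_map X (Euclidean_space e) g"
  shows "continuous_map X (Euclidean_space (1 + d + e)) (\<lambda>x. join d e (f x) (t x) (g x))"
  unfolding continuous_map_Euclidean_space_iff
proof (intro conjI allI impI)
  fix i assume "i < 1 + d + e"
  \<comment> \<open>The three blocks of the joined vector; the third starts at index
    \<open>d + 1\<close>, whence the shift.\<close>
  then consider "i < d" | "i = d" | "d < i" "i - (d + 1) < e" by linarith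
  then show "continuous_map X euclideanreal (\<lambda>x. join d e (f x) (t x) (g x) i)"
    using assms \<open>i < 1 + d + e\<close>
    by cases (auto simp: join_def continuous_map_Euclidean_space_iff)
qed (auto simp: Rn_eq join_def)

text \<open>Finitely many continuous nonvanishing functions keep their signs near each point, so the
  preimage of any set at all is open.\<close>

lemma continuous_map_discrete_sign_pattern:
  assumes cont: "\<And>l. l < n \<Longrightarrow> continuous_map X euclideanreal (\<lambda>x. T x l)"
    and nz: "\<And>x l. x \<in> topspace X \<Longrightarrow> l < n \<Longrightarrow> T x l \<noteq> 0"
  shows "continuous_map X (discrete_topology UNIV) (\<lambda>x. Heaviside_vec n (T x))"
  unfolding continuous_map_def
proof (intro conjI allI impI)
  fix V :: "(nat \<Rightarrow> real) set"
  show "openin X {x \<in> topspace X. Heaviside_vec n (T x) \<in> V}"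
  proof (subst openin_subopen, intro ballI)
    fix y assume y: "y \<in> {x \<in> topspace X. Heaviside_vec n (T x) \<in> V}"
    \<comment> \<open>A positive product says that \<open>T x l\<close> and \<open>T y l\<close>
      have the same strict sign. The last intersection covers \<open>n = 0\<close>, where the
      indexed one is the whole type.\<close>
    define U where "U = (\<Inter>l\<in>{..<n}. {x \<in> topspace X. T x l * T y l \<in> {0<..}}) \<inter> topspace X"
    have "openin X U"
      unfolding U_def
    proof (rule openin_INT)
      fix l assume "l \<in> {..<n}"
      then have "continuous_map X euclideanreal (\<lambda>x. T x l * T y l)"
        by (auto intro!: continuous_map_real_mult cont)
      then show "openin X {x \<in> topspace X. T x l * T y l \<in> {0<..}}"
        by (rule openin_continuous_map_preimage) simp
    qed simp
    moreover have "y \<in> U"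
      \<comment> \<open>At \<open>y\<close> itself the products are squares of nonzero
        numbers.\<close>
      using y nz by (fastforce simp: U_def zero_less_mult_iff)
    moreover have "U \<subseteq> {x \<in> topspace X. Heaviside_vec n (T x) \<in> V}"
    proof
      fix x assume "x \<in> U"
      have "Heaviside_vec n (T x) l = Heaviside_vec n (T y) l" for l
      proof (cases "l < n")
        case True
        then have "0 < T x l * T y l"
          using \<open>x \<in> U\<close> by (auto simp: U_def)
        then have "T x l \<ge> 0 \<longleftrightarrow> T y l \<ge> 0"
          by (auto simp: zero_less_mult_iff)
        then show ?thesis
          by (simp add: Heaviside_vec_def Heaviside_def)
      qed (simp add: Heaviside_vec_def)
      then have "Heaviside_vec n (T x) = Heaviside_vec n (T y)" ..
      with y \<open>x \<in> U\<close> show "x \<in> {x \<in> topspace X. Heaviside_vec n (T x) \<in> V}"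
        by (simp add: U_def)
    qed
    ultimately show "\<exists>U. openin X U \<and> y \<in> U \<and> U \<subseteq> {x \<in> topspace X. Heaviside_vec n (T x) \<in> V}"
      by blast
  qed
qed auto

lemma z_P_in_Rn: "z_P d Ss x \<in> Rn (d_P Ss)"
  by (simp add: Rn_eq z_P_def Heaviside_vec_def)

text \<open>Removing \<open>Gamma_P\<close> removes exactly the zeros of the coordinates of
  \<open>T_P\<close>.\<close>

lemma continuous_map_z_P:
  "continuous_map (subtopology (Euclidean_space d) (Rn d - Gamma_P d Ss)) (discrete_topology UNIV)
     (z_P d Ss)"
  unfolding z_P_def
proof (rule continuous_map_discrete_sign_pattern)
  show "continuous_map (subtopology (Euclidean_space d) (Rn d - Gamma_P d Ss)) euclideanreal
      (\<lambda>x. T_P d Ss x l)" for l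
    unfolding T_P_def
    by (cases "l < d_P Ss")
      (auto intro!: continuous_map_diff continuous_map_from_subtopology continuous_map_dot)
qed (auto simp: Gamma_P_def)

theorem proposition4p2:
  fixes d :: nat and \<H> :: "(nat \<Rightarrow> real) set set" and Ss :: "system list"
    and F :: "(nat \<Rightarrow> real) \<times> real \<Rightarrow> nat \<Rightarrow> real"
  assumes "finite \<H>" and "\<And>H. H \<in> \<H> \<Longrightarrow> affine_hyperplane d H"
    and "induced_partition d \<H> Ss"
    and "F \<in> geometry_preserving d Ss"
  shows "continuous_map
           (subtopology (prod_topology (Euclidean_space d) euclideanreal) ((Rn d - Gamma_P d Ss) \<times> UNIV))
           (Euclidean_space d) F"
proof -
  define X where "X = subtopology (Euclidean_space d) (Rn d - Gamma_P d Ss)"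
  define Y where "Y = prod_topology X euclideanreal"
  have Y: "subtopology (prod_topology (Euclidean_space d) euclideanreal)
      ((Rn d - Gamma_P d Ss) \<times> UNIV) = Y"
    by (simp add: X_def Y_def prod_topology_subtopology)
  obtain e \<Phi> \<Psi> where \<Phi>: "\<Phi> \<in> ReLU_jump_networks (d_P Ss) e"
    and \<Psi>: "\<Psi> \<in> ReLU_networks (1 + d + e) d"
    and F: "\<And>x t. x \<in> Rn d \<Longrightarrow> F (x, t) = \<Psi> (join d e x t (\<Phi> (z_P d Ss x)))"
    using assms(4) unfolding geometry_preserving_def by blast
  \<comment> \<open>The jumps of \<Phi> become harmless here: on a discrete space every map into the
    target is continuous.\<close>
  have "continuous_map (discrete_topology (Rn (d_P Ss))) (Euclidean_space e) \<Phi>"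
    using ReLU_jump_networks_in_Rn[OF \<Phi>] by auto
  moreover have "continuous_map X (discrete_topology (Rn (d_P Ss))) (z_P d Ss)"
  proof -
    \<comment> \<open>The codomain of \<open>z_P\<close> is cut down to \<open>Rn (d_P Ss)\<close>,
      since \<Phi> is controlled only there.\<close>
    have "discrete_topology (Rn (d_P Ss)) = subtopology (discrete_topology UNIV) (Rn (d_P Ss))"
      by simp
    then show ?thesis
      unfolding X_def
      using continuous_map_z_P z_P_in_Rn by (metis continuous_map_into_subtopology funcsetI)
  qed
  ultimately have "continuous_map X (Euclidean_space e) (\<Phi> \<circ> z_P d Ss)"
    by (rule continuous_map_compose[rotated])
  moreover have fst: "continuous_map Y X fst"
    by (simp add: Y_def continuous_map_fst)
  ultimately have "continuous_map Y (Euclidean_space e) (\<lambda>p. \<Phi> (z_P d Ss (fst p)))"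
    using continuous_map_compose by (force simp: o_def)
  moreover have "continuous_map Y (Euclidean_space d) fst"
    using fst by (simp add: X_def continuous_map_in_subtopology)
  moreover have "continuous_map Y euclideanreal snd"
    by (simp add: Y_def continuous_map_snd)
  ultimately have "continuous_map Y (Euclidean_space (1 + d + e))
      (\<lambda>p. join d e (fst p) (snd p) (\<Phi> (z_P d Ss (fst p))))"
    by (intro continuous_map_join)
  from continuous_map_compose[OF this continuous_map_ReLU_networks[OF \<Psi>]]
  have "continuous_map Y (Euclidean_space d) F"
    \<comment> \<open>\<open>F\<close> is known to equal the composite only for first components in
      \<open>Rn d\<close>, which holds throughout the topspace of \<open>Y\<close>.\<close>
    by (rule continuous_map_eq) (auto simp: Y_def X_def F)
  then show ?thesis
    by (simp only: Y)
qed

end
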